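(* Consider the extended trust region problem $$\mathrm{(P)}\qquad z^*=\inf\{\, f_0(x) : x\in\mathbb{R}^n,\ f_1(x)\le 0,\ f_2(x)\le 0,\ Bx\le b\,\},$$ with $f_0(x)=x^\top Q_0x+2q_0^\top x$, $f_1(x)=x^\top Q_1x+2q_1^\top x-1$, $f_2(x)=\|Ax-a\|^2-1$, whose feasible set is assumed non-empty. For $y=(s,x)\in\mathbb{R}^p\times\mathbb{R}^n$ put $\bar f_i(y)=f_i(x)$ for $i=0,1,2$ and $\bar f_3(y)=\|Bx+s-b\|^2$, and let $$\Omega:=\{[\bar f_0(y),\bar f_1(y),\bar f_2(y),\bar f_3(y)]^\top : y\in\mathbb{R}^p_+\times\mathbb{R}^n\}+\mathbb{R}^4_+ .$$ Suppose that $\Omega$ is closed and convex. Then $z^*_{\rm COP}=z^*$, where $z^*_{\rm COP}$ is the optimal value of the copositive relaxation of (P).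
   Context: Data: $Q_0,Q_1$ are real symmetric $n\times n$ matrices, $A$ is a real $\ell\times n$ matrix, $B$ is a real $p\times n$ matrix, $a\in\mathbb{R}^\ell$, $b\in\mathbb{R}^p$, $q_0,q_1\in\mathbb{R}^n$; norms are Euclidean and $Bx\le b$ is componentwise. Values are in $[-\infty,+\infty]$, with $\sup\emptyset=-\infty$ and $\inf\emptyset=+\infty$. Lagrangian: for $y=(s,x)\in\mathbb{R}^p\times\mathbb{R}^n$, $u\in\mathbb{R}^3_+$, $v\in\mathbb{R}^p$, let $L(y;u,v)=\bar f_0(y)+\sum_{i=1}^3u_i\bar f_i(y)-v^\top s$. Shor matrix: for a quadratic function $q(y)=y^\top Hy-2d^\top y+\gamma$ on $\mathbb{R}^N$ ($H$ symmetric), $M(q)=\begin{bmatrix}\gamma&-d^\top\\-d&H\end{bmatrix}$, a symmetric matrix of order $N+1$. $J_0$ denotes the matrix of order $p+n+1$ whose $(1,1)$ entry is $1$ and all of whose other entries are $0$. Copositivity: for a closed convex cone $\Gamma$, a symmetric matrix $Q$ is $\Gamma$-copositive if $w^\top Qw\ge0$ for all $w\in\Gamma$. Let $\Upsilon=\mathbb{R}^{p+1}_+\times\mathbb{R}^n$. Copositive relaxation value: $z^*_{\rm COP}=\sup\{\mu : (\mu,u)\in\mathbb{R}\times\mathbb{R}^3_+,\ M(L(\cdot;u,0))-\mu J_0\ \text{is}\ \Upsilon\text{-copositive}\}$. *)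

theory Defs
  imports "HOL-Analysis.Analysis"
begin

definition obj :: "real^'n^'n \<Rightarrow> real^'n \<Rightarrow> real^'n \<Rightarrow> real" where
  "obj Q0 q0 x = x \<bullet> (Q0 *v x) + 2 * (q0 \<bullet> x)"

definition con1 :: "real^'n^'n \<Rightarrow> real^'n \<Rightarrow> real^'n \<Rightarrow> real" where
  "con1 Q1 q1 x = x \<bullet> (Q1 *v x) + 2 * (q1 \<bullet> x) - 1"

definition con2 :: "real^'n^'l \<Rightarrow> real^'l \<Rightarrow> real^'n \<Rightarrow> real" where
  "con2 A a x = (norm (A *v x - a))\<^sup>2 - 1"

definition feasible ::
  "real^'n^'n \<Rightarrow> real^'n \<Rightarrow> real^'n^'l \<Rightarrow> real^'l \<Rightarrow> real^'n^'p \<Rightarrow> real^'p \<Rightarrow> (real^'n) set" where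
  "feasible Q1 q1 A a B b =
     {x. con1 Q1 q1 x \<le> 0 \<and> con2 A a x \<le> 0 \<and> (\<forall>i. (B *v x) $ i \<le> b $ i)}"

definition z_star ::
  "real^'n^'n \<Rightarrow> real^'n \<Rightarrow> real^'n^'n \<Rightarrow> real^'n \<Rightarrow> real^'n^'l \<Rightarrow> real^'l
    \<Rightarrow> real^'n^'p \<Rightarrow> real^'p \<Rightarrow> ereal" where
  "z_star Q0 q0 Q1 q1 A a B b = (INF x \<in> feasible Q1 q1 A a B b. ereal (obj Q0 q0 x))"

text \<open>A pair \<open>y = (s, x)\<close> is a single vector over the index type \<open>'p + 'n\<close>, with \<open>s\<close> in the
  \<open>Inl\<close> coordinates and \<open>x\<close> in the \<open>Inr\<close> coordinates.\<close>

definition slack_part :: "real^('p::finite + 'n::finite) \<Rightarrow> real^'p" where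
  "slack_part y = (\<chi> i. y $ Inl i)"

definition x_part :: "real^('p::finite + 'n::finite) \<Rightarrow> real^'n" where
  "x_part y = (\<chi> j. y $ Inr j)"

definition obj_bar :: "real^'n^'n \<Rightarrow> real^'n \<Rightarrow> real^('p::finite + 'n::finite) \<Rightarrow> real" where
  "obj_bar Q0 q0 y = obj Q0 q0 (x_part y)"

definition con1_bar :: "real^'n^'n \<Rightarrow> real^'n \<Rightarrow> real^('p::finite + 'n::finite) \<Rightarrow> real" where
  "con1_bar Q1 q1 y = con1 Q1 q1 (x_part y)"

definition con2_bar :: "real^'n^'l \<Rightarrow> real^'l \<Rightarrow> real^('p::finite + 'n::finite) \<Rightarrow> real" where
  "con2_bar A a y = con2 A a (x_part y)"

definition con3_bar :: "real^'n^'p \<Rightarrow> real^'p \<Rightarrow> real^('p::finite + 'n::finite) \<Rightarrow> real" where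
  "con3_bar B b y = (norm (B *v x_part y + slack_part y - b))\<^sup>2"

definition Omega ::
  "real^'n^'n \<Rightarrow> real^'n \<Rightarrow> real^'n^'n \<Rightarrow> real^'n \<Rightarrow> real^'n^'l \<Rightarrow> real^'l
    \<Rightarrow> real^'n^'p \<Rightarrow> real^'p \<Rightarrow> (real^4) set" where
  "Omega Q0 q0 Q1 q1 A a B b =
     {vector [obj_bar Q0 q0 y, con1_bar Q1 q1 y, con2_bar A a y, con3_bar B b y] + r | y r.
        (\<forall>i. 0 \<le> slack_part y $ i) \<and> (\<forall>k. 0 \<le> r $ k)}"

definition lagrangian ::
  "real^'n^'n \<Rightarrow> real^'n \<Rightarrow> real^'n^'n \<Rightarrow> real^'n \<Rightarrow> real^'n^'l \<Rightarrow> real^'l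
    \<Rightarrow> real^'n^'p \<Rightarrow> real^'p \<Rightarrow> real^3 \<Rightarrow> real^'p \<Rightarrow> real^('p::finite + 'n::finite) \<Rightarrow> real" where
  "lagrangian Q0 q0 Q1 q1 A a B b u v y =
     obj_bar Q0 q0 y
     + (u $ 1 * con1_bar Q1 q1 y + u $ 2 * con2_bar A a y + u $ 3 * con3_bar B b y)
     - v \<bullet> slack_part y"

text \<open>Matrices of order \<open>N + 1\<close> are indexed by \<open>'N option\<close>; \<open>None\<close> is the leading index.\<close>

definition bordered :: "real \<Rightarrow> real^'N \<Rightarrow> real^'N^'N \<Rightarrow> real^('N::finite option)^('N option)" where
  "bordered \<gamma> d H = (\<chi> i j. case i of
       None \<Rightarrow> (case j of None \<Rightarrow> \<gamma> | Some l \<Rightarrow> - d $ l)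
     | Some k \<Rightarrow> (case j of None \<Rightarrow> - d $ k | Some l \<Rightarrow> H $ k $ l))"

definition represents_quadratic ::
  "real^'N^'N \<Rightarrow> real^'N \<Rightarrow> real \<Rightarrow> (real^'N \<Rightarrow> real) \<Rightarrow> bool" where
  "represents_quadratic H d \<gamma> q \<longleftrightarrow>
     transpose H = H \<and> (\<forall>y. q y = y \<bullet> (H *v y) - 2 * (d \<bullet> y) + \<gamma>)"

text \<open>Junk value if \<open>q\<close> is not quadratic; well defined otherwise, by \<open>Shor_matrix_eq\<close> below.\<close>

definition Shor_matrix :: "(real^'N \<Rightarrow> real) \<Rightarrow> real^('N::finite option)^('N option)" where
  "Shor_matrix q = (THE M. \<exists>H d \<gamma>. represents_quadratic H d \<gamma> q \<and> M = bordered \<gamma> d H)"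

lemma represents_quadratic_unique:
  fixes q :: "real^'N::finite \<Rightarrow> real"
  assumes "represents_quadratic H d \<gamma> q" "represents_quadratic H' d' \<gamma>' q"
  shows "H = H'" "d = d'" "\<gamma> = \<gamma>'"
proof -
  have sym: "transpose H = H" "transpose H' = H'"
    using assms by (auto simp: represents_quadratic_def)
  have eq: "y \<bullet> (H *v y) - 2 * (d \<bullet> y) + \<gamma> = y \<bullet> (H' *v y) - 2 * (d' \<bullet> y) + \<gamma>'" for y
    using assms by (metis represents_quadratic_def)
  show g: "\<gamma> = \<gamma>'"
    using eq[of 0] by simp
  have minus: "(- y) \<bullet> (K *v (- y)) = y \<bullet> (K *v y)" for K :: "real^'N^'N" and y
    using matrix_vector_mult_scaleR[of K "-1" y] by simp
  have d: "d \<bullet> y = d' \<bullet> y" for y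
    using eq[of y] eq[of "- y"] g unfolding minus by simp
  then show "d = d'"
    using vector_eq_rdot by blast
  have quad: "y \<bullet> (H *v y) = y \<bullet> (H' *v y)" for y
    using eq[of y] g d[of y] by simp
  have swap: "y \<bullet> (K *v x) = x \<bullet> (K *v y)" if "transpose K = K" for K :: "real^'N^'N" and x y
    by (metis dot_lmul_matrix inner_commute that transpose_matrix_vector)
  have bil: "x \<bullet> (H *v y) = x \<bullet> (H' *v y)" for x y
    using quad[of "x + y"] quad[of x] quad[of y] swap[OF sym(1), of y x] swap[OF sym(2), of y x]
    by (simp add: matrix_vector_right_distrib inner_add_left inner_add_right)
  then show "H = H'"
    by (metis matrix_eq vector_eq_ldot)
qed

lemma Shor_matrix_eq:
  assumes "represents_quadratic H d \<gamma> q"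
  shows "Shor_matrix q = bordered \<gamma> d H"
  unfolding Shor_matrix_def
proof (rule the_equality)
  show "\<exists>H' d' \<gamma>'. represents_quadratic H' d' \<gamma>' q \<and> bordered \<gamma> d H = bordered \<gamma>' d' H'"
    using assms by blast
next
  fix M assume "\<exists>H' d' \<gamma>'. represents_quadratic H' d' \<gamma>' q \<and> M = bordered \<gamma>' d' H'"
  then show "M = bordered \<gamma> d H"
    using represents_quadratic_unique[OF assms] by metis
qed

definition J0 :: "real^('N::finite option)^('N option)" where
  "J0 = (\<chi> i j. if i = None \<and> j = None then 1 else 0)"

definition copositive_on :: "(real^'m) set \<Rightarrow> real^'m^'m \<Rightarrow> bool" where
  "copositive_on \<Gamma> Q \<longleftrightarrow> transpose Q = Q \<and> (\<forall>w\<in>\<Gamma>. 0 \<le> w \<bullet> (Q *v w))"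

definition Upsilon :: "(real^(('p::finite + 'n::finite) option)) set" where
  "Upsilon = {w. 0 \<le> w $ None \<and> (\<forall>i. 0 \<le> w $ Some (Inl i))}"

lemma closed_Upsilon: "closed (Upsilon :: (real^(('p::finite + 'n::finite) option)) set)"
  unfolding Upsilon_def
  by (intro closed_Collect_conj closed_Collect_all closed_Collect_le continuous_intros)

lemma convex_cone_Upsilon:
  "convex_cone (Upsilon :: (real^(('p::finite + 'n::finite) option)) set)"
  unfolding convex_cone_def conic_def convex_def
  by (auto simp: Upsilon_def intro!: add_nonneg_nonneg mult_nonneg_nonneg exI[of _ 0])

definition z_COP ::
  "real^'n^'n \<Rightarrow> real^'n \<Rightarrow> real^'n^'n \<Rightarrow> real^'n \<Rightarrow> real^'n^'l \<Rightarrow> real^'l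
    \<Rightarrow> real^'n^'p \<Rightarrow> real^'p \<Rightarrow> ereal" where
  "z_COP Q0 q0 Q1 q1 A a B b =
     Sup {ereal \<mu> | \<mu> u. (\<forall>i. 0 \<le> u $ i) \<and>
       copositive_on Upsilon
         (Shor_matrix (lagrangian Q0 q0 Q1 q1 A a B b u 0) - \<mu> *\<^sub>R J0)}"

end

theory Submission
  imports Defs
begin

text \<open>Homogenisation turns copositivity of the Shor matrix of \<open>L(\<cdot>; u, 0) - \<mu>\<close> into the bound
  \<open>\<mu> \<le> L(y; u, 0)\<close> for all \<open>y\<close> with non-negative slack, so the copositive relaxation is the
  Lagrangian dual with respect to \<open>u\<close>, and weak duality is clear. Conversely, if \<open>\<mu> < z\<^sup>*\<close>, the point
  \<open>(\<mu>, 0, 0, 0)\<close> lies outside the closed convex set \<open>\<Omega>\<close> and can be strictly separated from it. The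
  normal is non-negative because \<open>\<Omega>\<close> is stable under adding non-negative vectors, and strictness of
  the separation at the image of a feasible point forces its first entry to be positive, which is why
  no Slater condition is needed. Normalising that entry to 1 yields the multipliers \<open>u\<close>.\<close>

section \<open>Quadratic functions\<close>

text \<open>Existence alone suffices: by \<open>Shor_matrix_eq\<close> any representation determines
  the Shor matrix, so the closure lemmas below replace computing the coefficients of the
  Lagrangian.\<close>

definition quadratic :: "(real^'N::finite \<Rightarrow> real) \<Rightarrow> bool" where
  "quadratic q \<longleftrightarrow> (\<exists>H d \<gamma>. represents_quadratic H d \<gamma> q)"

lemma quadratic_add:
  assumes "quadratic q" "quadratic q'"
  shows "quadratic (\<lambda>y. q y + q' y)"
proof -
  obtain H d \<gamma> H' d' \<gamma>' where
    "represents_quadratic H d \<gamma> q" "represents_quadratic H' d' \<gamma>' q'"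
    using assms unfolding quadratic_def by blast
  then have "represents_quadratic (H + H') (d + d') (\<gamma> + \<gamma>') (\<lambda>y. q y + q' y)"
    unfolding represents_quadratic_def
    by (auto simp: transpose_def vec_eq_iff matrix_vector_mult_add_rdistrib inner_add_left
        inner_add_right)
  then show ?thesis unfolding quadratic_def by blast
qed

lemma quadratic_cmult:
  assumes "quadratic q"
  shows "quadratic (\<lambda>y. c * q y)"
proof -
  obtain H d \<gamma> where "represents_quadratic H d \<gamma> q"
    using assms unfolding quadratic_def by blast
  then have "represents_quadratic (c *\<^sub>R H) (c *\<^sub>R d) (c * \<gamma>) (\<lambda>y. c * q y)"
    unfolding represents_quadratic_def
    by (auto simp: transpose_scalar scaleR_matrix_vector_assoc[symmetric] distrib_left
        right_diff_distrib)
  then show ?thesis unfolding quadratic_def by blast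
qed

lemma quadratic_const: "quadratic (\<lambda>y. c)"
proof -
  have "represents_quadratic 0 0 c (\<lambda>y. c)"
    by (simp add: represents_quadratic_def transpose_def vec_eq_iff)
  then show ?thesis unfolding quadratic_def by blast
qed

lemma dot_rmul_matrix:
  fixes P :: "real^'N::finite^'m::finite"
  shows "y \<bullet> (z v* P) = (P *v y) \<bullet> z"
  by (metis dot_lmul_matrix inner_commute)

lemma quadratic_obj_linear:
  fixes Q :: "real^'m^'m" and P :: "real^'N::finite^'m"
  assumes "transpose Q = Q"
  shows "quadratic (\<lambda>y. obj Q q (P *v y))"
proof -
  \<comment> \<open>The minus sign reconciles the \<open>+ 2 * (q \<bullet> x)\<close> of
    \<open>obj\<close> with the \<open>- 2 * (d \<bullet> y)\<close> of
    \<open>represents_quadratic\<close>.\<close>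
  have "represents_quadratic (transpose P ** Q ** P) (- (transpose P *v q)) 0
      (\<lambda>y. obj Q q (P *v y))"
    using assms
    by (simp add: represents_quadratic_def obj_def matrix_transpose_mul matrix_mul_assoc
        matrix_vector_mul_assoc[symmetric] dot_lmul_matrix dot_rmul_matrix)
  then show ?thesis unfolding quadratic_def by blast
qed

lemma quadratic_norm_affine:
  fixes P :: "real^'N::finite^'m"
  shows "quadratic (\<lambda>y. (norm (P *v y - c))\<^sup>2)"
proof -
  have comm: "(P *v y) \<bullet> c = c \<bullet> (P *v y)" for y
    by (rule inner_commute)
  have "represents_quadratic (transpose P ** P) (transpose P *v c) (c \<bullet> c)
      (\<lambda>y. (norm (P *v y - c))\<^sup>2)"
    by (simp add: represents_quadratic_def matrix_transpose_mul
        matrix_vector_mul_assoc[symmetric] dot_lmul_matrix dot_rmul_matrix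
        power2_norm_eq_inner inner_diff_left inner_diff_right comm)
  then show ?thesis unfolding quadratic_def by blast
qed

lemma linear_x_part: "linear x_part"
  by (rule linearI) (simp_all add: x_part_def vec_eq_iff)

lemma linear_slack_part: "linear slack_part"
  by (rule linearI) (simp_all add: slack_part_def vec_eq_iff)

text \<open>Ensures that the Shor matrix in \<open>z_COP\<close> is not a junk value. Once the
  projections of \<open>y\<close> are written as matrices, each term is a quadratic function of a
  linear image of \<open>y\<close>.\<close>

lemma quadratic_lagrangian:
  fixes Q0 Q1 :: "real^'n^'n" and A :: "real^'n^'l" and B :: "real^'n^'p"
  assumes "transpose Q0 = Q0" "transpose Q1 = Q1"
  shows "quadratic (lagrangian Q0 q0 Q1 q1 A a B b u 0)"
proof -
  define X :: "real^('p + 'n)^'n" where "X = matrix x_part"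
  have X: "x_part y = X *v y" for y
    unfolding X_def by (simp add: matrix_works linear_x_part)
  define S :: "real^('p + 'n)^'p" where "S = B ** X + matrix slack_part"
  have S: "B *v (X *v y) + slack_part y = S *v y" for y
    unfolding S_def
    by (simp add: matrix_works linear_slack_part matrix_vector_mul_assoc
        matrix_vector_mult_add_rdistrib)
  \<comment> \<open>The form \<open>+ - 1\<close> lets the constants match
    \<open>quadratic_add\<close> and \<open>quadratic_const\<close>.\<close>
  have "lagrangian Q0 q0 Q1 q1 A a B b u 0 = (\<lambda>y.
      obj Q0 q0 (X *v y)
      + (u $ 1 * (obj Q1 q1 (X *v y) + - 1)
        + u $ 2 * ((norm ((A ** X) *v y - a))\<^sup>2 + - 1)
        + u $ 3 * (norm (S *v y - b))\<^sup>2))"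
    by (rule ext) (simp add: lagrangian_def obj_bar_def con1_bar_def con1_def con2_bar_def
        con2_def con3_bar_def S obj_def X matrix_vector_mul_assoc[symmetric])
  then show ?thesis
    by (simp only:) (intro quadratic_add quadratic_cmult quadratic_const quadratic_obj_linear
        quadratic_norm_affine assms)
qed

section \<open>Copositivity of the Shor matrix\<close>

lemma sum_UNIV_option: "sum f (UNIV :: 'a::finite option set) = f None + (\<Sum>k\<in>UNIV. f (Some k))"
  by (simp add: UNIV_option_conv sum.reindex)

text \<open>With \<open>w = (t, y)\<close> and \<open>q\<close> represented by \<open>H\<close>,
  \<open>d\<close>, \<open>\<gamma>\<close>, the right-hand side is the homogenisation of
  \<open>q - \<mu>\<close>: for nonzero \<open>t\<close> it equals t squared times
  \<open>q (y / t) - \<mu>\<close>.\<close>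

lemma quadratic_form_bordered:
  "w \<bullet> ((bordered \<gamma> d H - \<mu> *\<^sub>R J0) *v w)
    = (w $ None)\<^sup>2 * (\<gamma> - \<mu>) - 2 * w $ None * (d \<bullet> (\<chi> k. w $ Some k))
      + (\<chi> k. w $ Some k) \<bullet> (H *v (\<chi> k. w $ Some k))"
proof -
  let ?v = "\<chi> k. w $ Some k"
  let ?M = "bordered \<gamma> d H - \<mu> *\<^sub>R J0"
  have "(?M *v w) $ None = (\<gamma> - \<mu>) * w $ None - d \<bullet> ?v"
    by (simp add: inner_vec_def matrix_vector_mult_def sum_UNIV_option bordered_def J0_def sum_negf)
  moreover have "(?M *v w) $ Some k = - (w $ None) * d $ k + (H *v ?v) $ k" for k
    by (simp add: matrix_vector_mult_def sum_UNIV_option bordered_def J0_def)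
  ultimately have "w \<bullet> (?M *v w) = w $ None * ((\<gamma> - \<mu>) * w $ None - d \<bullet> ?v)
      + ?v \<bullet> (- (w $ None) *\<^sub>R d + H *v ?v)"
    by (simp add: inner_vec_def[of w] inner_vec_def[of ?v "_ - _"] sum_UNIV_option)
  then show ?thesis
    by (simp add: inner_diff_right inner_commute[of ?v d] power2_eq_square algebra_simps)
qed

lemma transpose_bordered:
  assumes "transpose H = H"
  shows "transpose (bordered \<gamma> d H - \<mu> *\<^sub>R J0) = bordered \<gamma> d H - \<mu> *\<^sub>R J0"
proof -
  have "H $ i $ j = H $ j $ i" for i j
    using assms by (metis transpose_def vec_lambda_beta)
  then show ?thesis
    by (auto simp: transpose_def vec_eq_iff bordered_def J0_def split: option.splits)
qed

text \<open>Non-negativity of the slack is preserved by positive scaling, so the bound at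
  \<open>y / t\<close> controls the form at \<open>(t, y)\<close> for positive \<open>t\<close>. The
  boundary value \<open>t = 0\<close> follows by continuity.\<close>

lemma copositive_Shor_iff:
  fixes q :: "real^('p::finite + 'n::finite) \<Rightarrow> real"
  assumes "quadratic q"
  shows "copositive_on Upsilon (Shor_matrix q - \<mu> *\<^sub>R J0)
    \<longleftrightarrow> (\<forall>y. (\<forall>i. 0 \<le> slack_part y $ i) \<longrightarrow> \<mu> \<le> q y)"
proof -
  obtain H d \<gamma> where rep: "represents_quadratic H d \<gamma> q"
    using assms unfolding quadratic_def by blast
  then have sym: "transpose H = H" and q: "\<And>y. q y = y \<bullet> (H *v y) - 2 * (d \<bullet> y) + \<gamma>"
    by (auto simp: represents_quadratic_def)
  let ?form = "\<lambda>t y. t\<^sup>2 * (\<gamma> - \<mu>) - 2 * t * (d \<bullet> y) + y \<bullet> (H *v y)"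
  have "copositive_on Upsilon (Shor_matrix q - \<mu> *\<^sub>R J0)
      \<longleftrightarrow> (\<forall>w\<in>Upsilon. 0 \<le> ?form (w $ None) (\<chi> k. w $ Some k))"
    unfolding copositive_on_def Shor_matrix_eq[OF rep] transpose_bordered[OF sym]
      quadratic_form_bordered by simp
  also have "\<dots> \<longleftrightarrow> (\<forall>t y. 0 \<le> t \<longrightarrow> (\<forall>i. 0 \<le> slack_part y $ i) \<longrightarrow> 0 \<le> ?form t y)"
  proof (intro iffI allI impI ballI)
    fix t :: real and y :: "real^('p + 'n)"
    assume form: "\<forall>w\<in>Upsilon. 0 \<le> ?form (w $ None) (\<chi> k. w $ Some k)"
      and "0 \<le> t" "\<forall>i. 0 \<le> slack_part y $ i"
    then show "0 \<le> ?form t y"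
      using form[rule_format, of "\<chi> k. case k of None \<Rightarrow> t | Some j \<Rightarrow> y $ j"]
      by (simp add: Upsilon_def slack_part_def)
  next
    fix w :: "real^('p + 'n) option"
    assume "\<forall>t y. 0 \<le> t \<longrightarrow> (\<forall>i. 0 \<le> slack_part y $ i) \<longrightarrow> 0 \<le> ?form t y"
      and "w \<in> Upsilon"
    then show "0 \<le> ?form (w $ None) (\<chi> k. w $ Some k)"
      by (auto simp: Upsilon_def slack_part_def)
  qed
  also have "\<dots> \<longleftrightarrow> (\<forall>y. (\<forall>i. 0 \<le> slack_part y $ i) \<longrightarrow> \<mu> \<le> q y)"
  proof (intro iffI allI impI)
    fix y :: "real^('p + 'n)"
    assume form: "\<forall>t y. 0 \<le> t \<longrightarrow> (\<forall>i. 0 \<le> slack_part y $ i) \<longrightarrow> 0 \<le> ?form t y"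
      and y: "\<forall>i. 0 \<le> slack_part y $ i"
    show "\<mu> \<le> q y"
      \<comment> \<open>At \<open>t = 1\<close> the form is \<open>q y - \<mu>\<close>.\<close>
      using form[rule_format, of 1 y] y by (simp add: q)
  next
    fix t :: real and y :: "real^('p + 'n)"
    assume bound: "\<forall>y. (\<forall>i. 0 \<le> slack_part y $ i) \<longrightarrow> \<mu> \<le> q y"
      and "0 \<le> t" and y: "\<forall>i. 0 \<le> slack_part y $ i"
    have pos: "0 \<le> ?form e y" if "0 < e" for e
    proof -
      have "\<mu> \<le> q ((1 / e) *\<^sub>R y)"
        using that y by (intro bound[rule_format]) (simp add: linear_scale[OF linear_slack_part])
      then have "0 \<le> e\<^sup>2 * (q ((1 / e) *\<^sub>R y) - \<mu>)"
        by simp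
      also have "\<dots> = ?form e y"
        using that by (simp add: q matrix_vector_mult_scaleR power2_eq_square field_simps)
      finally show ?thesis .
    qed
    show "0 \<le> ?form t y"
    proof (cases "t = 0")
      case True
      \<comment> \<open>There is no point \<open>y / t\<close> here; the form is the limit of its
        non-negative values at small positive \<open>e\<close>.\<close>
      have "((\<lambda>e. ?form e y) \<longlongrightarrow> ?form 0 y) (at_right 0)"
        by (intro tendsto_intros)
      moreover have "\<forall>\<^sub>F e in at_right 0. 0 \<le> ?form e y"
        using pos by (auto simp: eventually_at_right_less eventually_at_filter)
      ultimately have "0 \<le> ?form 0 y"
        by (rule tendsto_lowerbound) simp
      then show ?thesis using True by simp
    qed (use pos \<open>0 \<le> t\<close> in simp)
  qed
  finally show ?thesis .
qed

section \<open>Lagrangian duality from a closed convex image\<close>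

text \<open>Coordinate \<open>i\<close> carries the objective and the others the constraints;
  \<open>y0\<close> is a feasible point, and \<open>lower\<close> says that \<open>\<mu>\<close>
  lies strictly below every feasible objective value.\<close>

lemma closed_convex_image_multipliers:
  fixes F :: "'y \<Rightarrow> real^'m::finite"
  assumes "closed {F y + r | y r. y \<in> Y \<and> (\<forall>k. 0 \<le> r $ k)}"
    and "convex {F y + r | y r. y \<in> Y \<and> (\<forall>k. 0 \<le> r $ k)}"
    and y0: "y0 \<in> Y" "\<And>k. k \<noteq> i \<Longrightarrow> F y0 $ k \<le> 0"
    and lower: "\<And>y. y \<in> Y \<Longrightarrow> (\<And>k. k \<noteq> i \<Longrightarrow> F y $ k \<le> 0) \<Longrightarrow> \<mu> < F y $ i"
  obtains l where "\<And>k. 0 \<le> l $ k" "l $ i = 1" "\<And>y. y \<in> Y \<Longrightarrow> \<mu> \<le> l \<bullet> F y"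
proof -
  define S where "S = {F y + r | y r. y \<in> Y \<and> (\<forall>k. 0 \<le> r $ k)}"
  have S: "closed S" "convex S"
    using assms(1,2) unfolding S_def by simp_all
  have F: "F y \<in> S" if "y \<in> Y" for y
    unfolding S_def using that by (intro CollectI exI[of _ y] exI[of _ 0]) simp
  \<comment> \<open>Membership would yield a feasible \<open>y\<close> with objective value at most
    \<open>\<mu>\<close>.\<close>
  have "axis i \<mu> \<notin> S"
  proof
    assume "axis i \<mu> \<in> S"
    then obtain y r where y: "y \<in> Y" "\<forall>k. 0 \<le> r $ k" and eq: "axis i \<mu> = F y + r"
      unfolding S_def by blast
    have le: "F y $ k \<le> axis i \<mu> $ k" for k
      unfolding eq using y(2) by simp
    have "F y $ k \<le> 0" if "k \<noteq> i" for k
      using le[of k] that by (simp add: axis_def)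
    then have "\<mu> < F y $ i"
      by (rule lower[OF y(1)])
    then show False
      using le[of i] by simp
  qed
  then obtain h c where h: "h \<bullet> axis i \<mu> < c" "\<And>w. w \<in> S \<Longrightarrow> c < h \<bullet> w"
    using separating_hyperplane_closed_point[OF S(2,1)] by blast
  have sep: "h $ i * \<mu> < h \<bullet> F y" if "y \<in> Y" for y
    using h(1) h(2)[OF F[OF that]] by (simp add: inner_axis)
  have nonneg: "0 \<le> h $ k" for k
  proof (rule ccontr)
    assume neg: "\<not> 0 \<le> h $ k"
    \<comment> \<open>The step length along \<open>axis k\<close> at which \<open>h\<close> drops
      from its value at \<open>F y0\<close> to exactly \<open>c\<close>; the point reached is still
      in \<open>S\<close>, where \<open>h\<close> exceeds \<open>c\<close>.\<close>
    define t where "t = (h \<bullet> F y0 - c) / (- h $ k)"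
    have "c < h \<bullet> F y0"
      by (rule h(2)[OF F[OF y0(1)]])
    then have "0 \<le> t"
      using neg by (simp add: t_def divide_le_0_iff)
    then have "\<forall>j. 0 \<le> axis k t $ j"
      by (simp add: axis_def)
    then have "c < h \<bullet> (F y0 + axis k t)"
      using y0(1) by (intro h(2)) (auto simp: S_def)
    also have "\<dots> = c"
      using neg by (simp add: t_def inner_add_right inner_axis field_simps)
    finally show False by simp
  qed
  \<comment> \<open>Otherwise \<open>sep\<close> at \<open>y0\<close> reads
    \<open>0 < h \<bullet> F y0\<close>, although only products of a non-negative weight and a
    non-positive constraint value remain.\<close>
  have "h $ i \<noteq> 0"
  proof
    assume "h $ i = 0"
    then have "h $ k * F y0 $ k \<le> 0" for k
      by (cases "k = i") (simp_all add: mult_nonneg_nonpos nonneg y0(2))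
    then have "h \<bullet> F y0 \<le> 0"
      by (simp add: inner_vec_def sum_nonpos)
    then show False
      using sep[OF y0(1)] \<open>h $ i = 0\<close> by simp
  qed
  then have pos: "0 < h $ i"
    using nonneg[of i] by simp
  show thesis
  proof (rule that[of "(1 / h $ i) *\<^sub>R h"])
    show "\<mu> \<le> ((1 / h $ i) *\<^sub>R h) \<bullet> F y" if "y \<in> Y" for y
      using sep[OF that] pos by (simp add: field_simps)
  qed (use nonneg pos in simp_all)
qed

section \<open>Slack reformulation of feasibility and equality of the two values\<close>

lemma vector_4:
  "vector [w, x, y, z] $ (1::4) = w" "vector [w, x, y, z] $ (2::4) = x"
  "vector [w, x, y, z] $ (3::4) = y" "vector [w, x, y, z] $ (4::4) = z"
  unfolding vector_def by simp_all

lemma ex_Inl_Inr_vec: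
  obtains y :: "real^('p::finite + 'n::finite)" where "slack_part y = s" "x_part y = x"
proof
  let ?y = "\<chi> k. case k of Inl i \<Rightarrow> s $ i | Inr j \<Rightarrow> x $ j"
  show "slack_part ?y = s" "x_part ?y = x"
    by (simp_all add: slack_part_def x_part_def vec_eq_iff)
qed

text \<open>A squared norm is at most 0 only if it vanishes, so the last condition forces the slack
  to be \<open>b - B *v x\<close>, whose non-negativity is the linear constraint.\<close>

lemma feasible_iff_slack:
  "x \<in> feasible Q1 q1 A a B b \<longleftrightarrow>
    (\<exists>y. x_part y = x \<and> (\<forall>i. 0 \<le> slack_part y $ i)
      \<and> con1_bar Q1 q1 y \<le> 0 \<and> con2_bar A a y \<le> 0 \<and> con3_bar B b y \<le> 0)"
proof
  assume x: "x \<in> feasible Q1 q1 A a B b"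
  obtain y where "slack_part y = b - B *v x" "x_part y = x"
    by (rule ex_Inl_Inr_vec)
  then show "\<exists>y. x_part y = x \<and> (\<forall>i. 0 \<le> slack_part y $ i)
      \<and> con1_bar Q1 q1 y \<le> 0 \<and> con2_bar A a y \<le> 0 \<and> con3_bar B b y \<le> 0"
    using x
    by (intro exI[of _ y]) (simp add: feasible_def con1_bar_def con2_bar_def con3_bar_def)
next
  assume "\<exists>y. x_part y = x \<and> (\<forall>i. 0 \<le> slack_part y $ i)
      \<and> con1_bar Q1 q1 y \<le> 0 \<and> con2_bar A a y \<le> 0 \<and> con3_bar B b y \<le> 0"
  then obtain y where y: "x_part y = x" "\<forall>i. 0 \<le> slack_part y $ i" "con1_bar Q1 q1 y \<le> 0"
      "con2_bar A a y \<le> 0" "con3_bar B b y \<le> 0"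
    by blast
  have "B *v x + slack_part y - b = 0"
    using y(1,5) by (simp add: con3_bar_def)
  then have "b = B *v x + slack_part y"
    by (simp only: right_minus_eq)
  then show "x \<in> feasible Q1 q1 A a B b"
    using y by (simp add: feasible_def con1_bar_def con2_bar_def)
qed

theorem theorem4p1:
  fixes Q0 Q1 :: "real^'n^'n" and q0 q1 :: "real^'n"
    and A :: "real^'n^'l" and a :: "real^'l"
    and B :: "real^'n^'p" and b :: "real^'p"
  assumes "transpose Q0 = Q0" and "transpose Q1 = Q1"
    and "feasible Q1 q1 A a B b \<noteq> {}"
    and "closed (Omega Q0 q0 Q1 q1 A a B b)"
    and "convex (Omega Q0 q0 Q1 q1 A a B b)"
  shows "z_COP Q0 q0 Q1 q1 A a B b = z_star Q0 q0 Q1 q1 A a B b"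
proof (rule antisym)
  let ?L = "\<lambda>u. lagrangian Q0 q0 Q1 q1 A a B b u 0"
  define Y :: "(real^('p + 'n)) set" where "Y = {y. \<forall>i. 0 \<le> slack_part y $ i}"
  \<comment> \<open>The relaxation becomes the Lagrangian dual over \<open>u\<close>; matrices no
    longer occur.\<close>
  have z_COP: "z_COP Q0 q0 Q1 q1 A a B b
      = Sup {ereal \<mu> | \<mu> u. (\<forall>i. 0 \<le> u $ i) \<and> (\<forall>y\<in>Y. \<mu> \<le> ?L u y)}"
    unfolding z_COP_def copositive_Shor_iff[OF quadratic_lagrangian[OF assms(1,2)]] Y_def by simp
  show "z_COP Q0 q0 Q1 q1 A a B b \<le> z_star Q0 q0 Q1 q1 A a B b"
    unfolding z_COP z_star_def
  proof (intro Sup_least INF_greatest)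
    fix m x
    assume "m \<in> {ereal \<mu> | \<mu> u. (\<forall>i. 0 \<le> u $ i) \<and> (\<forall>y\<in>Y. \<mu> \<le> ?L u y)}"
    then obtain \<mu> and u :: "real^3" where u: "m = ereal \<mu>" "\<forall>i. 0 \<le> u $ i" "\<forall>y\<in>Y. \<mu> \<le> ?L u y"
      by blast
    assume "x \<in> feasible Q1 q1 A a B b"
    then obtain y where y: "x_part y = x" "y \<in> Y" and con: "con1_bar Q1 q1 y \<le> 0"
        "con2_bar A a y \<le> 0" "con3_bar B b y \<le> 0"
      unfolding feasible_iff_slack Y_def by blast
    have "\<mu> \<le> ?L u y"
      using u(3) y(2) by blast
    also have "\<dots> \<le> obj Q0 q0 x"
      using u(2) con y(1)
      by (simp add: lagrangian_def obj_bar_def add_nonpos_nonpos mult_nonneg_nonpos)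
    finally show "m \<le> ereal (obj Q0 q0 x)"
      using u(1) by simp
  qed
  show "z_star Q0 q0 Q1 q1 A a B b \<le> z_COP Q0 q0 Q1 q1 A a B b"
  \<comment> \<open>Approaching from below supplies the strict inequality that separation needs, and
    avoids a case distinction on whether \<open>z_star\<close> is finite.\<close>
  proof (rule dense_le)
    fix m assume m: "m < z_star Q0 q0 Q1 q1 A a B b"
    show "m \<le> z_COP Q0 q0 Q1 q1 A a B b"
    proof (cases m)
      case (real \<mu>)
      let ?F = "\<lambda>y. vector [obj_bar Q0 q0 y, con1_bar Q1 q1 y, con2_bar A a y, con3_bar B b y] :: real^4"
      have Omega: "Omega Q0 q0 Q1 q1 A a B b
          = {?F y + r | y r. y \<in> Y \<and> (\<forall>k. 0 \<le> r $ k)}"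
        unfolding Omega_def Y_def by simp
      have con: "(\<forall>k. k \<noteq> 1 \<longrightarrow> ?F y $ k \<le> 0) \<longleftrightarrow>
          con1_bar Q1 q1 y \<le> 0 \<and> con2_bar A a y \<le> 0 \<and> con3_bar B b y \<le> 0" for y
        by (simp add: forall_4 vector_4)
      obtain y0 where y0: "y0 \<in> Y" "\<forall>k. k \<noteq> 1 \<longrightarrow> ?F y0 $ k \<le> 0"
        using assms(3) unfolding con ex_in_conv[symmetric] feasible_iff_slack Y_def by blast
      have lower: "\<mu> < ?F y $ 1" if "y \<in> Y" "\<And>k. k \<noteq> 1 \<Longrightarrow> ?F y $ k \<le> 0" for y
      proof -
        have "con1_bar Q1 q1 y \<le> 0 \<and> con2_bar A a y \<le> 0 \<and> con3_bar B b y \<le> 0"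
          using that(2) con by blast
        then have "x_part y \<in> feasible Q1 q1 A a B b"
          using that(1) unfolding feasible_iff_slack Y_def by blast
        then have "z_star Q0 q0 Q1 q1 A a B b \<le> ereal (obj Q0 q0 (x_part y))"
          unfolding z_star_def by (rule INF_lower)
        with m have "ereal \<mu> < ereal (obj Q0 q0 (x_part y))"
          unfolding real by (rule less_le_trans)
        then show ?thesis
          by (simp add: obj_bar_def vector_4)
      qed
      obtain l where l: "\<And>k. 0 \<le> l $ k" "l $ 1 = 1" "\<And>y. y \<in> Y \<Longrightarrow> \<mu> \<le> l \<bullet> ?F y"
        using closed_convex_image_multipliers[of ?F Y y0 1 \<mu>] assms(4,5) y0 lower
        unfolding Omega by blast
      \<comment> \<open>The entry \<open>l $ 1 = 1\<close> weighs the objective; the other three,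
        shifted down by one index, are the multipliers.\<close>
      define u :: "real^3" where "u = vector [l $ 2, l $ 3, l $ 4]"
      have "l \<bullet> ?F y = ?L u y" for y
        by (simp add: inner_vec_def sum_4 vector_4 u_def l(2) lagrangian_def)
      then have "\<forall>y\<in>Y. \<mu> \<le> ?L u y"
        using l(3) by simp
      moreover have "\<forall>i. 0 \<le> u $ i"
        using l(1) by (simp add: u_def forall_3)
      ultimately show ?thesis
        unfolding z_COP real by (intro Sup_upper) blast
    \<comment> \<open>The value \<infinity> is excluded by \<open>m\<close>, and -\<infinity> is
      below everything.\<close>
    qed (use m in auto)
  qed
qed

end
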